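(* Let $f:\mathbb{R}^n\to\mathbb{R}$ be bounded below, with $f^*=\inf_{x\in\mathbb{R}^n}f(x)>-\infty$. Let $x_0\in\mathbb{R}^n$, $\tilde\alpha_0>0$, $c>0$, and let $D=\{d_1,\dots,d_p\}\subset\mathbb{R}^n$ be a finite set ($|D|=p$). (i) The stepsize initialization algorithm with input $(x_0,\tilde\alpha_0,c,D)$ outputs $\alpha_0$ satisfying $$1\le\frac{\alpha_0}{\tilde\alpha_0}\le M,\qquad M=\max\left\{1,\,2\sqrt{\frac{f(x_0)-f^*}{c\tilde\alpha_0^2}}\right\},$$ and performs in total at most $$|D|+\log_2M=|D|+\max\left\{0,\,1+\frac12\log_2\left(\frac{f(x_0)-f^*}{c\tilde\alpha_0^2}\right)\right\}$$ function evaluations (not counting the evaluation of $f(x_0)$). (ii) If $f$ is convex, then the output satisfies $$f(x_0+\alpha_0d)>f(x_0)-c\alpha_0^2\quad\text{for all } d\in D.$$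
   Context: Stepsize initialization algorithm. Input: $x_0\in\mathbb{R}^n$, $\tilde\alpha_0>0$, $c>0$, $D=\{d_1,\dots,d_p\}$. Set $i\leftarrow1$ and $\alpha\leftarrow\tilde\alpha_0$. While $i\le|D|$: if $f(x_0+\alpha d_i)\le f(x_0)-c\alpha^2$, then set $\alpha\leftarrow2\alpha$; else set $i\leftarrow i+1$. Output $\alpha_0=\alpha$. Each pass through the loop uses one function evaluation, that of $f(x_0+\alpha d_i)$. When $f(x_0)=f^*$, $\log_2 0$ is read as $-\infty$. *)

theory Defs
  imports "HOL-Analysis.Analysis" "HOL-Library.While_Combinator"
begin

text \<open>
  A loop state \<open>(i, \<alpha>, N)\<close> consists of the index of the current direction, the current
  stepsize, and the number of function evaluations made so far. Each pass evaluates \<open>f\<close> exactly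
  once, at \<open>x0 + \<alpha> d\<^sub>i\<close>; the value \<open>f x0\<close> is regarded as already known and is not counted.
\<close>

definition stepsize_init_step ::
  "(real ^ 'n \<Rightarrow> real) \<Rightarrow> real ^ 'n \<Rightarrow> real \<Rightarrow> (nat \<Rightarrow> real ^ 'n)
    \<Rightarrow> nat \<times> real \<times> nat \<Rightarrow> nat \<times> real \<times> nat"
where
  "stepsize_init_step f x0 c d = (\<lambda>(i, \<alpha>, N).
     if f (x0 + \<alpha> *\<^sub>R d i) \<le> f x0 - c * \<alpha>\<^sup>2
     then (i, 2 * \<alpha>, N + 1)
     else (i + 1, \<alpha>, N + 1))"

text \<open>
  The directions are \<open>d 1, \<dots>, d p\<close>; other values of \<open>d\<close> are never inspected. The result is
  \<open>Some (\<alpha>, N)\<close> with the final stepsize and the total number of function evaluations if the loop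
  terminates, and \<open>None\<close> if it does not.
\<close>

definition stepsize_init ::
  "(real ^ 'n \<Rightarrow> real) \<Rightarrow> real ^ 'n \<Rightarrow> real \<Rightarrow> real \<Rightarrow> (nat \<Rightarrow> real ^ 'n) \<Rightarrow> nat
    \<Rightarrow> (real \<times> nat) option"
where
  "stepsize_init f x0 \<alpha>_init c d p =
     map_option snd
       (while_option (\<lambda>(i, \<alpha>, N). i \<le> p) (stepsize_init_step f x0 c d) (1, \<alpha>_init, 0))"

text \<open>The library sets \<open>log 2 0 = 0\<close>, whereas here \<open>log\<^sub>2 0 = -\<infinity>\<close> is needed.\<close>

definition elog2 :: "real \<Rightarrow> ereal" where
  "elog2 x = (if x = 0 then - \<infinity> else ereal (log 2 x))"

end

theory Submission
  imports Defs
begin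

text \<open>
  Every state \<open>(i, \<alpha>, N)\<close> reached by the loop has \<open>\<alpha> = 2 ^ k * \<alpha>_init\<close> with \<open>N + 1 = k + i\<close>.
  A successful test at \<open>\<alpha>\<close> forces \<open>c * \<alpha>\<^sup>2 \<le> f x0 - fstar\<close>, hence \<open>2 ^ k \<le> M\<close> is
  preserved, which bounds \<open>N\<close> and gives termination. For convex \<open>f\<close>, a direction that fails the
  test at \<open>\<alpha>\<close> also fails it at \<open>2 * \<alpha>\<close>, so the directions already passed stay rejected.
\<close>

text \<open>For t > 0, \<open>log 2\<close> is monotone, so it commutes with \<open>max\<close>, and
  the factor 2 contributes the summand 1. At t = 0 the value \<open>-\<infinity>\<close> of
  \<open>elog2\<close> is absorbed by \<open>max 0\<close>, matching log 1 = 0 on the left.\<close>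

lemma elog2_max_eq:
  assumes "t \<ge> 0"
  shows "ereal (log 2 (max 1 (2 * sqrt t))) = max 0 (1 + ereal (1 / 2) * elog2 t)"
proof (cases "t = 0")
  case True
  then show ?thesis
    by (simp add: elog2_def)
next
  case False
  with assms have t: "t > 0"
    by simp
  have "log 2 (max 1 (2 * sqrt t)) = max (log 2 1) (log 2 (2 * sqrt t))"
    using t by (auto simp: max_def)
  also have "log 2 (2 * sqrt t) = 1 + 1 / 2 * log 2 t"
    using t by (simp add: log_def ln_mult ln_sqrt field_simps)
  finally show ?thesis
    using t by (simp add: elog2_def one_ereal_def zero_ereal_def)
qed

text \<open>The decrease c * \<alpha>^2 cannot exceed the gap v - m above a lower bound m; dividing
  by c * a^2 and taking roots gives the claim. It is applied with v = \<open>f x0\<close>, m =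
  \<open>fstar\<close> and a = \<open>\<alpha>_init\<close>.\<close>

lemma sufficient_decrease_stepsize_le:
  fixes c \<alpha> a u v m :: real
  assumes "u \<le> v - c * \<alpha>\<^sup>2" "m \<le> u" "c > 0" "a > 0" "\<alpha> > 0"
  shows "\<alpha> / a \<le> sqrt ((v - m) / (c * a\<^sup>2))"
proof (rule real_le_rsqrt)
  have "c * \<alpha>\<^sup>2 \<le> v - m"
    using assms by linarith
  then show "(\<alpha> / a)\<^sup>2 \<le> (v - m) / (c * a\<^sup>2)"
    using assms by (simp add: field_simps)
qed

text \<open>The point at \<alpha> is the midpoint of x and the point at 2 * \<alpha>, so convexity
  bounds the value at 2 * \<alpha> below by 2 * f (x + \<alpha> v) - f x > f x - 2 * c * \<alpha>^2,
  which is at least f x - 4 * c * \<alpha>^2.\<close>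

lemma convex_no_decrease_double:
  fixes f :: "'a::real_vector \<Rightarrow> real"
  assumes "convex_on UNIV f" "c \<ge> 0" and gt: "f (x + \<alpha> *\<^sub>R v) > f x - c * \<alpha>\<^sup>2"
  shows "f (x + (2 * \<alpha>) *\<^sub>R v) > f x - c * (2 * \<alpha>)\<^sup>2"
proof -
  have "x + \<alpha> *\<^sub>R v = (1 - 1 / 2) *\<^sub>R x + (1 / 2) *\<^sub>R (x + (2 * \<alpha>) *\<^sub>R v)"
    by (simp add: scaleR_add_right flip: scaleR_add_left)
  then have "f (x + \<alpha> *\<^sub>R v) \<le> (1 - 1 / 2) * f x + 1 / 2 * f (x + (2 * \<alpha>) *\<^sub>R v)"
    using convex_onD[OF assms(1), of "1 / 2" x "x + (2 * \<alpha>) *\<^sub>R v"] by simp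
  moreover have "0 \<le> c * \<alpha>\<^sup>2"
    using assms by simp
  ultimately show ?thesis
    using gt by (simp add: power_mult_distrib)
qed

theorem lemma5:
  fixes f :: "real ^ 'n \<Rightarrow> real"
    and x0 :: "real ^ 'n"
    and \<alpha>_init c fstar M :: real
    and D :: "(real ^ 'n) set"
    and d :: "nat \<Rightarrow> real ^ 'n"
    and p :: nat
  assumes bounded_below: "bdd_below (range f)"
    and fstar: "fstar = (INF x. f x)"
    and \<alpha>_init_pos: "\<alpha>_init > 0"
    and c_pos: "c > 0"
    and D_enum: "bij_betw d {1..p} D"
    and M: "M = max 1 (2 * sqrt ((f x0 - fstar) / (c * \<alpha>_init\<^sup>2)))"
  shows "\<exists>\<alpha>0 N. stepsize_init f x0 \<alpha>_init c d p = Some (\<alpha>0, N)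
    \<and> (1 \<le> \<alpha>0 / \<alpha>_init \<and> \<alpha>0 / \<alpha>_init \<le> M
       \<and> real N \<le> real (card D) + log 2 M
       \<and> ereal (real (card D) + log 2 M)
           = ereal (real (card D))
             + max 0 (1 + ereal (1 / 2) * elog2 ((f x0 - fstar) / (c * \<alpha>_init\<^sup>2))))
    \<and> (convex_on UNIV f \<longrightarrow> (\<forall>v\<in>D. f (x0 + \<alpha>0 *\<^sub>R v) > f x0 - c * \<alpha>0\<^sup>2))"
proof -
  define t where "t = (f x0 - fstar) / (c * \<alpha>_init\<^sup>2)"
  have fstar_le: "fstar \<le> f x" for x
    unfolding fstar using bounded_below by (rule cINF_lower) simp
  have "t \<ge> 0"
    using fstar_le[of x0] c_pos by (simp add: t_def)
  have M1: "M \<ge> 1" and Mt: "2 * sqrt t \<le> M"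
    by (auto simp: M t_def)
  have card: "card D = p"
    using bij_betw_same_card[OF D_enum] by simp
  have power_le_M: "real k \<le> log 2 M" if "2 ^ k \<le> M" for k
    using that M1 by (simp add: le_log_iff powr_realpow)
  \<comment> \<open>Here \<open>k\<close> counts doublings and \<open>i - 1\<close> counts
    rejections. The last clause refers to the current \<alpha>, not to the stepsize at which
    direction \<open>j\<close> failed, so that at exit it speaks of the output.\<close>
  define inv where "inv = (\<lambda>(i, \<alpha>, N). \<exists>k.
      \<alpha> = 2 ^ k * \<alpha>_init \<and> 2 ^ k \<le> M \<and> N + 1 = k + i \<and> 1 \<le> i \<and> i \<le> p + 1 \<and>
      (convex_on UNIV f \<longrightarrow> (\<forall>j\<in>{1..<i}. f (x0 + \<alpha> *\<^sub>R d j) > f x0 - c * \<alpha>\<^sup>2)))"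
  define rank where "rank = (\<lambda>(i :: nat, \<alpha> :: real, N). nat \<lfloor>log 2 M\<rfloor> + p - N)"
  let ?b = "\<lambda>(i, \<alpha> :: real, N :: nat). i \<le> p"
  have inv_init: "inv (1, \<alpha>_init, 0)"
    unfolding inv_def using M1 by (auto intro: exI[of _ 0])
  have step: "inv (stepsize_init_step f x0 c d s) \<and> rank (stepsize_init_step f x0 c d s) < rank s"
    if "inv s" and guard: "?b s" for s
  proof -
    obtain i \<alpha> N where s: "s = (i, \<alpha>, N)"
      by (cases s)
    from guard have ip: "i \<le> p"
      by (simp add: s)
    from \<open>inv s\<close> obtain k where k: "\<alpha> = 2 ^ k * \<alpha>_init" "2 ^ k \<le> M" "N + 1 = k + i" "1 \<le> i"
      and rej: "convex_on UNIV f \<Longrightarrow> j \<in> {1..<i} \<Longrightarrow> f (x0 + \<alpha> *\<^sub>R d j) > f x0 - c * \<alpha>\<^sup>2" for j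
      by (auto simp: inv_def s)
    have "k \<le> nat \<lfloor>log 2 M\<rfloor>"
      using power_le_M[OF k(2)] by (simp add: le_nat_floor)
    \<comment> \<open>Strictness keeps the natural subtraction in \<open>rank\<close> from being
      truncated, so raising \<open>N\<close> by one really lowers it.\<close>
    then have "N < nat \<lfloor>log 2 M\<rfloor> + p"
      using k(3) ip by linarith
    then have "rank (stepsize_init_step f x0 c d s) < rank s"
      by (auto simp: s rank_def stepsize_init_step_def)
    moreover have "inv (stepsize_init_step f x0 c d s)"
    proof (cases "f (x0 + \<alpha> *\<^sub>R d i) \<le> f x0 - c * \<alpha>\<^sup>2")
      case True
      have "\<alpha> / \<alpha>_init \<le> sqrt t"
        unfolding t_def using True fstar_le c_pos \<alpha>_init_pos
        by (rule sufficient_decrease_stepsize_le) (simp add: k(1) \<alpha>_init_pos)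
      \<comment> \<open>The accepted stepsize gives 2^k <= sqrt t; the factor 2 in \<open>M\<close>
        pays for the doubling that follows.\<close>
      then have "2 ^ Suc k \<le> M"
        using Mt \<alpha>_init_pos by (simp add: k(1))
      moreover have "f (x0 + (2 * \<alpha>) *\<^sub>R d j) > f x0 - c * (2 * \<alpha>)\<^sup>2"
        if "convex_on UNIV f" "j \<in> {1..<i}" for j
        using convex_no_decrease_double[OF that(1) _ rej[OF that]] c_pos by simp
      ultimately show ?thesis
        using True k ip by (auto simp: inv_def s stepsize_init_step_def intro!: exI[of _ "Suc k"])
    next
      case False
      then have "f (x0 + \<alpha> *\<^sub>R d j) > f x0 - c * \<alpha>\<^sup>2"
        if "convex_on UNIV f" "j \<in> {1..<Suc i}" for j
        using rej[OF that(1), of j] that(2) by (cases "j = i") auto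
      then show ?thesis
        using False k ip by (auto simp: inv_def s stepsize_init_step_def intro!: exI[of _ k])
    qed
    ultimately show ?thesis
      by blast
  qed
  obtain i \<alpha>0 N where
    run: "while_option ?b (stepsize_init_step f x0 c d) (1, \<alpha>_init, 0) = Some (i, \<alpha>0, N)"
    using measure_while_option_Some[where b = ?b, OF step inv_init] by auto
  have "inv (i, \<alpha>0, N)"
    using while_option_rule[where P = inv, OF _ run inv_init] step by blast
  \<comment> \<open>Together with \<open>i \<le> p + 1\<close> this forces i = p + 1: there are
    exactly p rejections, and the rejected indices are all of 1..p.\<close>
  moreover have "\<not> i \<le> p"
    using while_option_stop[OF run] by simp
  ultimately obtain k where k: "\<alpha>0 = 2 ^ k * \<alpha>_init" "2 ^ k \<le> M" "N = k + p"
    and rej: "convex_on UNIV f \<Longrightarrow> j \<in> {1..p} \<Longrightarrow> f (x0 + \<alpha>0 *\<^sub>R d j) > f x0 - c * \<alpha>0\<^sup>2" for j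
    by (auto simp: inv_def)
  have "stepsize_init f x0 \<alpha>_init c d p = Some (\<alpha>0, N)"
    unfolding stepsize_init_def run by simp
  moreover have "1 \<le> \<alpha>0 / \<alpha>_init" "\<alpha>0 / \<alpha>_init \<le> M"
    using \<alpha>_init_pos k(1,2) by simp_all
  moreover have "real N \<le> real (card D) + log 2 M"
    using power_le_M[OF k(2)] by (simp add: k(3) card)
  moreover have "ereal (real (card D) + log 2 M) = ereal (real (card D))
      + max 0 (1 + ereal (1 / 2) * elog2 ((f x0 - fstar) / (c * \<alpha>_init\<^sup>2)))"
    using elog2_max_eq[OF \<open>t \<ge> 0\<close>] by (simp add: M t_def flip: plus_ereal.simps(1))
  moreover have "f (x0 + \<alpha>0 *\<^sub>R v) > f x0 - c * \<alpha>0\<^sup>2" if "convex_on UNIV f" "v \<in> D" for v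
    using rej[OF that(1)] that(2) D_enum by (auto simp: bij_betw_def)
  ultimately show ?thesis
    by blast
qed

end
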